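(* Let $n\ge 2$, let $h:[n]\to[n]$ be a Hessenberg function, and let $\lambda=(\lambda_1,\lambda_2)$ be a composition of $n$ with two positive parts. Let $0\le k\le\lambda_2$, and if $\lambda_1>1$ assume additionally that $h(k+2)=n$. Then the function $f^{(k)}_\lambda:S_n\to\mathbb{C}[t_1,\dots,t_n]$ defined by $$f^{(k)}_\lambda(yv)=\begin{cases}\prod_{t_a-t_b\in\mathcal S_k}(t_{y(a)}-t_{y(b)}) & \text{if } v\ge v_k,\\ 0 & \text{otherwise,}\end{cases}\qquad (y\in S_\lambda,\ v\in{}^\lambda S_n)$$ is a well-defined equivariant cohomology class in $H_T^{2|\mathcal S_k|}(\mathrm{Hess}(\mathsf S,h))$, i.e. it satisfies all the GKM divisibility conditions.
   Context: Notation: $[n]=\{1,\dots,n\}$. A Hessenberg function is a nondecreasing map $h:[n]\to[n]$ with $h(i)\ge i$ for all $i$. The group $S_n$ acts on $\mathbb{C}[t_1,\dots,t_n]$ by ring automorphisms with $v(t_i)=t_{v(i)}$; in particular on "roots" $t_i-t_j$. Let $\Phi^+=\{t_i-t_j: i<j\}$, $\Phi^-=\{t_i-t_j:i>j\}$, $\Phi_h^-=\{t_i-t_j: i>j,\ i\le h(j)\}$, $N(w)=\{\gamma\in\Phi^+: w(\gamma)\in\Phi^-\}$, $N^-(w)=\{\gamma\in\Phi^-: w(\gamma)\in\Phi^+\}$, $N_h^-(w)=N^-(w)\cap\Phi_h^-$. For a root $\gamma=t_i-t_j$, $s_\gamma$ is the transposition exchanging $i$ and $j$; $s_i$ is the transposition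 of $i,i+1$. Let $\mathsf S$ be a regular semisimple $n\times n$ complex matrix and $\mathrm{Hess}(\mathsf S,h)=\{V_\bullet\text{ full flags in }\mathbb{C}^n:\ \mathsf S V_i\subseteq V_{h(i)}\ \forall i\}$, with the action of the diagonal torus $T$. Via GKM theory, $H_T^*(\mathrm{Hess}(\mathsf S,h))$ (complex coefficients) is identified with the set of tuples $f=(f(w))_{w\in S_n}$ of polynomials in $\mathbb{C}[t_1,\dots,t_n]$ such that for every $w\in S_n$ and every $\gamma=t_i-t_j\in N_h^-(w)$, the polynomial $t_{w(i)}-t_{w(j)}$ divides $f(w)-f(ws_\gamma)$; $H^{2d}_T$ consists of those tuples whose entries are homogeneous of degree $d$ (or zero). Bruhat order on $S_n$ is denoted $\le$. Two-part compositions: $S_\lambda$ is the subgroup generated by $s_i$, $i\neq\lambda_1$. ${}^\lambda S_n$ is the set of $v\in S_n$ with $v^{-1}(1)<\dots<v^{-1}(\lambda_1)$ and $v^{-1}(\lambda_1+1)<\dots<v^{-1}(n)$ (minimal-length representatives of right cosets $S_\lambda\backslash S_n$); every $w\in S_n$ is uniquely $w=yv$ with $y\in S_\lambda$, $v\in{}^\lambda S_n$. For $0\le k\le\lambda_2$, $v_k\in S_n$ is the permutation with one-line notation $[\lambda_1+1,\lambda_1+2,\dots,\lambda_1+k,\,1,\,\lambda_1+k+1,\dots,n,\,2,3,\dots,\lambda_1]$ (the entry $1$ in position $k+1$). Set $\mathcal S_k=v_k(N_h^-(v_k))=\{t_a-t_b: a<b,\ v_k^{-1}(a)>v_k^{-1}(b),\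 v_k^{-1}(a)\le h(v_k^{-1}(b))\}$. *)

theory Defs
  imports
    Complex_Main
    "HOL-Library.FuncSet"
    "HOL-Library.Poly_Mapping"
    "HOL-Algebra.Sym_Groups"
begin

section \<open>Polynomials\<close>

text \<open>
  Polynomials over the complex numbers are finitely supported functions on exponent vectors,
  with convolution as multiplication. The type provides a variable for every natural number;
  \<open>polys n\<close> is the polynomial ring in the variables with index \<open>1, ..., n\<close>.
\<close>

type_synonym mpoly = "(nat \<Rightarrow>\<^sub>0 nat) \<Rightarrow>\<^sub>0 complex"

definition var :: "nat \<Rightarrow> mpoly" where
  "var i = Poly_Mapping.single (Poly_Mapping.single i 1) 1"

definition polys :: "nat \<Rightarrow> mpoly set" where
  "polys n = {p. \<forall>m \<in> Poly_Mapping.keys p. Poly_Mapping.keys m \<subseteq> {1..n}}"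

definition poly_dvd :: "nat \<Rightarrow> mpoly \<Rightarrow> mpoly \<Rightarrow> bool" where
  "poly_dvd n p q \<longleftrightarrow> (\<exists>r \<in> polys n. q = p * r)"

text \<open>The zero polynomial is homogeneous of every degree.\<close>

definition homogeneous :: "nat \<Rightarrow> mpoly \<Rightarrow> bool" where
  "homogeneous d p \<longleftrightarrow> (\<forall>m \<in> Poly_Mapping.keys p. (\<Sum>i \<in> Poly_Mapping.keys m. Poly_Mapping.lookup m i) = d)"


section \<open>Permutations and roots\<close>

text \<open>
  The root \<open>t i - t j\<close>, with distinct \<open>i\<close> and \<open>j\<close>, determines \<open>i\<close> and \<open>j\<close> and is represented by
  the pair \<open>(i, j)\<close>. Since a permutation \<open>w\<close> maps \<open>t i\<close> to \<open>t (w i)\<close>, it acts on pairs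
  componentwise, and \<open>root_poly\<close> recovers the polynomial.
\<close>

type_synonym root = "nat \<times> nat"

definition root_poly :: "root \<Rightarrow> mpoly" where
  "root_poly = (\<lambda>(i, j). var i - var j)"

definition act :: "(nat \<Rightarrow> nat) \<Rightarrow> root \<Rightarrow> root" where
  "act w = (\<lambda>(i, j). (w i, w j))"

definition refl_perm :: "root \<Rightarrow> nat \<Rightarrow> nat" where
  "refl_perm = (\<lambda>(i, j). transpose i j)"

definition Phi_pos :: "nat \<Rightarrow> root set" where
  "Phi_pos n = {(i, j). i \<in> {1..n} \<and> j \<in> {1..n} \<and> i < j}"

definition Phi_neg :: "nat \<Rightarrow> root set" where
  "Phi_neg n = {(i, j). i \<in> {1..n} \<and> j \<in> {1..n} \<and> i > j}"

definition Phi_neg_h :: "nat \<Rightarrow> (nat \<Rightarrow> nat) \<Rightarrow> root set" where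
  "Phi_neg_h n h = {(i, j). i \<in> {1..n} \<and> j \<in> {1..n} \<and> i > j \<and> i \<le> h j}"

definition N_pos :: "nat \<Rightarrow> (nat \<Rightarrow> nat) \<Rightarrow> root set" where
  "N_pos n w = {\<gamma> \<in> Phi_pos n. act w \<gamma> \<in> Phi_neg n}"

definition N_neg :: "nat \<Rightarrow> (nat \<Rightarrow> nat) \<Rightarrow> root set" where
  "N_neg n w = {\<gamma> \<in> Phi_neg n. act w \<gamma> \<in> Phi_pos n}"

definition N_neg_h :: "nat \<Rightarrow> (nat \<Rightarrow> nat) \<Rightarrow> (nat \<Rightarrow> nat) \<Rightarrow> root set" where
  "N_neg_h n h w = N_neg n w \<inter> Phi_neg_h n h"

abbreviation Sn :: "nat \<Rightarrow> (nat \<Rightarrow> nat) set" where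
  "Sn n \<equiv> carrier (sym_group n)"

definition perm_length :: "nat \<Rightarrow> (nat \<Rightarrow> nat) \<Rightarrow> nat" where
  "perm_length n w = card (N_pos n w)"

text \<open>
  Bruhat order: the reflexive-transitive closure of multiplication by a reflection that
  increases the length.
\<close>

definition bruhat_step :: "nat \<Rightarrow> (nat \<Rightarrow> nat) \<Rightarrow> (nat \<Rightarrow> nat) \<Rightarrow> bool" where
  "bruhat_step n u w \<longleftrightarrow> u \<in> Sn n \<and>
     (\<exists>\<gamma> \<in> Phi_pos n. w = u \<circ> refl_perm \<gamma>) \<and> perm_length n u < perm_length n w"

definition bruhat_le :: "nat \<Rightarrow> (nat \<Rightarrow> nat) \<Rightarrow> (nat \<Rightarrow> nat) \<Rightarrow> bool" where
  "bruhat_le n = (bruhat_step n)\<^sup>*\<^sup>*"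


section \<open>Equivariant cohomology of Hessenberg varieties\<close>

definition hessenberg :: "nat \<Rightarrow> (nat \<Rightarrow> nat) \<Rightarrow> bool" where
  "hessenberg n h \<longleftrightarrow> h \<in> {1..n} \<rightarrow> {1..n} \<and> mono_on {1..n} h \<and> (\<forall>i \<in> {1..n}. i \<le> h i)"

text \<open>
  \<open>HT n h\<close> is the GKM presentation of the torus-equivariant cohomology ring, with complex
  coefficients, of the regular semisimple Hessenberg variety of \<open>h\<close>: tuples of polynomials
  indexed by the torus-fixed points. It does not depend on the choice of the regular
  semisimple matrix. \<open>HT_even n h d\<close> is the part of cohomological degree \<open>2 * d\<close>.
\<close>

definition HT :: "nat \<Rightarrow> (nat \<Rightarrow> nat) \<Rightarrow> ((nat \<Rightarrow> nat) \<Rightarrow> mpoly) set" where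
  "HT n h = {f \<in> Sn n \<rightarrow>\<^sub>E polys n.
     \<forall>w \<in> Sn n. \<forall>\<gamma> \<in> N_neg_h n h w.
       poly_dvd n (root_poly (act w \<gamma>)) (f w - f (w \<circ> refl_perm \<gamma>))}"

definition HT_even :: "nat \<Rightarrow> (nat \<Rightarrow> nat) \<Rightarrow> nat \<Rightarrow> ((nat \<Rightarrow> nat) \<Rightarrow> mpoly) set" where
  "HT_even n h d = {f \<in> HT n h. \<forall>w \<in> Sn n. homogeneous d (f w)}"


section \<open>Two-part compositions and the classes\<close>

text \<open>The composition of \<open>n\<close> with parts \<open>l\<close> and \<open>n - l\<close> is represented by \<open>n\<close> and \<open>l\<close>.\<close>

definition young_subgroup :: "nat \<Rightarrow> nat \<Rightarrow> (nat \<Rightarrow> nat) set" where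
  "young_subgroup n l =
     generate (sym_group n) {transpose i (Suc i) | i. 1 \<le> i \<and> i < n \<and> i \<noteq> l}"

definition min_reps :: "nat \<Rightarrow> nat \<Rightarrow> (nat \<Rightarrow> nat) set" where
  "min_reps n l = {v \<in> Sn n. strict_mono_on {1..l} (inv' v) \<and> strict_mono_on {l+1..n} (inv' v)}"

definition one_line :: "nat list \<Rightarrow> nat \<Rightarrow> nat" where
  "one_line xs i = (if 1 \<le> i \<and> i \<le> length xs then xs ! (i - 1) else i)"

definition vk :: "nat \<Rightarrow> nat \<Rightarrow> nat \<Rightarrow> nat \<Rightarrow> nat" where
  "vk n l k = one_line ([l+1..<l+k+1] @ [1] @ [l+k+1..<n+1] @ [2..<l+1])"

definition Sk :: "nat \<Rightarrow> nat \<Rightarrow> (nat \<Rightarrow> nat) \<Rightarrow> nat \<Rightarrow> root set" where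
  "Sk n l h k = act (vk n l k) ` N_neg_h n h (vk n l k)"

definition f_value ::
  "nat \<Rightarrow> nat \<Rightarrow> (nat \<Rightarrow> nat) \<Rightarrow> nat \<Rightarrow> (nat \<Rightarrow> nat) \<Rightarrow> (nat \<Rightarrow> nat) \<Rightarrow> mpoly" where
  "f_value n l h k y v =
     (if bruhat_le n (vk n l k) v
      then \<Prod>(a, b) \<in> Sk n l h k. (var (y a) - var (y b)) else 0)"

text \<open>
  The value at \<open>w\<close> is computed from the factorization \<open>w = y \<circ> v\<close>. The function
  \<open>the_inv_into\<close> returns this factorization provided that it exists and is unique, which is
  part of the well-definedness of the class.
\<close>

definition f_class ::
  "nat \<Rightarrow> nat \<Rightarrow> (nat \<Rightarrow> nat) \<Rightarrow> nat \<Rightarrow> (nat \<Rightarrow> nat) \<Rightarrow> mpoly" where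
  "f_class n l h k =
     (\<lambda>w \<in> Sn n.
        let (y, v) = the_inv_into (young_subgroup n l \<times> min_reps n l) (\<lambda>(y, v). y \<circ> v) w
        in f_value n l h k y v)"

end

theory Submission
  imports Defs "HOL-Library.Infinite_Set"
begin

text \<open>
  A minimal representative \<open>v\<close> lies above \<open>v\<^sub>k\<close> exactly when its first \<open>k\<close> values exceed \<open>l\<close> and
  its values after position \<open>n - l + 1\<close> do not. Since only one small value is then free to move,
  \<open>v = v\<^sub>m\<close> for some \<open>m \<ge> k\<close>. Consider a GKM edge from \<open>w = y v\<close> at the positions \<open>j < i \<le> h j\<close>.
  If \<open>v\<close> sends \<open>i\<close> and \<open>j\<close> to the same side of \<open>l\<close>, the edge stays in the coset and the two values of
  the class differ by a transposition of variables. If the edge leaves the support of the class,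
  then \<open>(v i, v j)\<close> belongs to \<open>S\<^sub>k\<close>, so the edge label is a factor of the class. If it joins
  two cosets in the support, the two Young subgroup components differ by a permutation of
  \<open>l + k + 1, ..., n\<close>. The condition \<open>h (k + 2) = n\<close> puts all pairs \<open>(a, b)\<close> with
  \<open>2 \<le> a \<le> l\<close> and \<open>b > l + k\<close> into \<open>S\<^sub>k\<close>, which is therefore invariant under this permutation.
\<close>

section \<open>Polynomials and divisibility\<close>

lemma polys_zero [simp]: "0 \<in> polys n"
  and polys_one [simp]: "1 \<in> polys n"
  by (auto simp: polys_def)

lemma polys_var: "i \<in> {1..n} \<Longrightarrow> var i \<in> polys n"
  by (auto simp: polys_def var_def)

lemma polys_diff: "p \<in> polys n \<Longrightarrow> q \<in> polys n \<Longrightarrow> p - q \<in> polys n"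
  unfolding polys_def using keys_diff[of p q] by blast

lemma polys_uminus: "p \<in> polys n \<Longrightarrow> - p \<in> polys n"
  using polys_diff[of 0 n p] by simp

lemma polys_add: "p \<in> polys n \<Longrightarrow> q \<in> polys n \<Longrightarrow> p + q \<in> polys n"
  using polys_diff[of p n "- q"] by (simp add: polys_uminus)

lemma polys_mult: "p \<in> polys n \<Longrightarrow> q \<in> polys n \<Longrightarrow> p * q \<in> polys n"
proof -
  assume pq: "p \<in> polys n" "q \<in> polys n"
  have "Poly_Mapping.keys m \<subseteq> {1..n}" if m: "m \<in> Poly_Mapping.keys (p * q)" for m
  proof -
    obtain a b where "m = a + b" "a \<in> Poly_Mapping.keys p" "b \<in> Poly_Mapping.keys q"
      using m keys_mult[of p q] by blast
    then show ?thesis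
      using pq keys_add[of a b] unfolding polys_def by blast
  qed
  then show ?thesis by (simp add: polys_def)
qed

lemma polys_prod: "(\<And>x. x \<in> A \<Longrightarrow> g x \<in> polys n) \<Longrightarrow> prod g A \<in> polys n"
  by (induction A rule: infinite_finite_induct) (auto intro: polys_mult)

text \<open>Both degrees can be summed over the union of the two supports, where
  \<open>lookup\<close> is additive.\<close>

lemma monomial_degree_add:
  fixes a b :: "nat \<Rightarrow>\<^sub>0 nat"
  shows "sum (Poly_Mapping.lookup (a + b)) (Poly_Mapping.keys (a + b)) =
    sum (Poly_Mapping.lookup a) (Poly_Mapping.keys a) +
    sum (Poly_Mapping.lookup b) (Poly_Mapping.keys b)"
proof -
  let ?S = "Poly_Mapping.keys a \<union> Poly_Mapping.keys b"
  have "sum (Poly_Mapping.lookup c) (Poly_Mapping.keys c) = sum (Poly_Mapping.lookup c) ?S"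
    if "Poly_Mapping.keys c \<subseteq> ?S" for c :: "nat \<Rightarrow>\<^sub>0 nat"
    using that by (intro sum.mono_neutral_left) (auto simp: in_keys_iff)
  from this[of a] this[of b] this[of "a + b"] show ?thesis
    using keys_add[of a b] by (simp add: lookup_add sum.distrib)
qed

lemma homogeneous_zero [simp]: "homogeneous d 0"
  by (simp add: homogeneous_def)

lemma homogeneous_mult: "homogeneous d p \<Longrightarrow> homogeneous e q \<Longrightarrow> homogeneous (d + e) (p * q)"
proof -
  assume pq: "homogeneous d p" "homogeneous e q"
  have "sum (Poly_Mapping.lookup m) (Poly_Mapping.keys m) = d + e"
    if m: "m \<in> Poly_Mapping.keys (p * q)" for m
  proof -
    obtain a b where "m = a + b" "a \<in> Poly_Mapping.keys p" "b \<in> Poly_Mapping.keys q"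
      using m keys_mult[of p q] by blast
    then show ?thesis
      using pq by (simp add: homogeneous_def monomial_degree_add)
  qed
  then show ?thesis by (simp add: homogeneous_def)
qed

lemma homogeneous_diff: "homogeneous d p \<Longrightarrow> homogeneous d q \<Longrightarrow> homogeneous d (p - q)"
  unfolding homogeneous_def using keys_diff[of p q] by blast

lemma homogeneous_var: "homogeneous 1 (var i)"
  by (simp add: homogeneous_def var_def)

lemma homogeneous_prod:
  "finite A \<Longrightarrow> (\<And>x. x \<in> A \<Longrightarrow> homogeneous 1 (g x)) \<Longrightarrow> homogeneous (card A) (prod g A)"
proof (induction A rule: finite_induct)
  case empty
  show ?case by (simp add: homogeneous_def)
next
  case (insert x A)
  then show ?case using homogeneous_mult[of 1 "g x" "card A" "prod g A"] by simp
qed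

lemma poly_dvd_zero [simp]: "poly_dvd n d 0"
  by (auto simp: poly_dvd_def intro: bexI[of _ 0])

lemma poly_dvd_self [simp]: "poly_dvd n d d"
  by (auto simp: poly_dvd_def intro: bexI[of _ 1])

lemma poly_dvd_uminus: "poly_dvd n d p \<Longrightarrow> poly_dvd n d (- p)"
  unfolding poly_dvd_def using polys_uminus by (metis mult_minus_right)

lemma poly_dvd_add: "poly_dvd n d p \<Longrightarrow> poly_dvd n d q \<Longrightarrow> poly_dvd n d (p + q)"
  unfolding poly_dvd_def using polys_add by (metis distrib_left)

lemma poly_dvd_mult_right: "poly_dvd n d p \<Longrightarrow> q \<in> polys n \<Longrightarrow> poly_dvd n d (p * q)"
  unfolding poly_dvd_def using polys_mult by (metis mult.assoc)

lemma poly_dvd_prod_factor: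
  assumes "finite A" "x \<in> A" "poly_dvd n d (g x)" "\<And>x. x \<in> A \<Longrightarrow> g x \<in> polys n"
  shows "poly_dvd n d (prod g A)"
  using assms by (auto simp: prod.remove intro!: poly_dvd_mult_right polys_prod)

text \<open>Exchanging the factors one at a time telescopes the difference; each exchange
  contributes a multiple of one \<open>f x - g x\<close>.\<close>

lemma poly_dvd_prod_diff:
  assumes "finite A" "\<And>x. x \<in> A \<Longrightarrow> f x \<in> polys n" "\<And>x. x \<in> A \<Longrightarrow> g x \<in> polys n"
    and "\<And>x. x \<in> A \<Longrightarrow> poly_dvd n d (f x - g x)"
  shows "poly_dvd n d (prod f A - prod g A)"
  using assms
proof (induction A rule: finite_induct)
  case (insert x A)
  have "prod f (insert x A) - prod g (insert x A) =
      (f x - g x) * prod f A + (prod f A - prod g A) * g x"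
    using insert.hyps by (simp add: algebra_simps)
  then show ?case
    using insert by (auto intro!: poly_dvd_add poly_dvd_mult_right polys_prod)
qed simp

lemma poly_dvd_var_transpose:
  "poly_dvd n (var p - var q) (var c - var (transpose p q c))"
  using poly_dvd_uminus[OF poly_dvd_self[of n "var p - var q"]]
  by (auto simp: transpose_def)

section \<open>The Young subgroup and minimal representatives\<close>

text \<open>Each generator respects the side of \<open>l\<close> because \<open>i = l\<close> is
  left out. Conversely, a permutation respecting the sides is a product of one permutation per
  block, and each of these is a product of transpositions inside its block.\<close>

lemma young_subgroup_iff:
  "y \<in> young_subgroup n l \<longleftrightarrow> y permutes {1..n} \<and> (\<forall>x\<in>{1..n}. y x \<le> l \<longleftrightarrow> x \<le> l)"
proof
  let ?H = "{transpose i (Suc i) | i. 1 \<le> i \<and> i < n \<and> i \<noteq> l}"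
  assume "y \<in> young_subgroup n l"
  then have "y \<in> generate (sym_group n) ?H" by (simp add: young_subgroup_def)
  then show "y permutes {1..n} \<and> (\<forall>x\<in>{1..n}. y x \<le> l \<longleftrightarrow> x \<le> l)"
  proof (induction rule: generate.induct)
    case one
    show ?case using permutes_id by (simp add: sym_group_one id_def)
  next
    case (incl t)
    then obtain i where i: "t = transpose i (Suc i)" "1 \<le> i" "i < n" "i \<noteq> l" by blast
    then have "t permutes {1..n}" by (auto intro!: permutes_swap_id)
    moreover have "t x \<le> l \<longleftrightarrow> x \<le> l" for x using i by (auto simp: transpose_def)
    ultimately show ?case by blast
  next
    case (inv t)
    then obtain i where i: "t = transpose i (Suc i)" "1 \<le> i" "i < n" "i \<noteq> l" by blast
    then have "t permutes {1..n}" by (auto intro!: permutes_swap_id)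
    moreover from this have "inv\<^bsub>sym_group n\<^esub> t = t" by (simp add: sym_group_carrier i(1))
    moreover have "t x \<le> l \<longleftrightarrow> x \<le> l" for x using i by (auto simp: transpose_def)
    ultimately show ?case by simp
  next
    case (eng y z)
    moreover from eng have "z x \<in> {1..n}" if "x \<in> {1..n}" for x
      using permutes_in_image that by metis
    moreover from eng have "y \<circ> z permutes {1..n}" by (blast intro: permutes_compose)
    ultimately show ?case by (simp add: sym_group_mult comp_def)
  qed
next
  let ?G = "sym_group n" and ?Y = "young_subgroup n l"
  have comp: "y \<circ> z \<in> ?Y" if "y \<in> ?Y" "z \<in> ?Y" for y z
    using generate.eng[of y ?G _ z] that by (simp add: young_subgroup_def sym_group_mult)
  have id: "id \<in> ?Y"
    using generate.one[of ?G] by (simp add: young_subgroup_def sym_group_one)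
  have simple: "transpose i (Suc i) \<in> ?Y" if "1 \<le> i" "i < n" "i \<noteq> l" for i
    unfolding young_subgroup_def using that by (intro generate.incl) blast
  \<comment> \<open>Induction on the upper end: conjugating \<open>transpose a b\<close> by the next
    simple transposition yields \<open>transpose a (Suc b)\<close>. The last side condition keeps
    \<open>l\<close> out of the indices that occur.\<close>
  have less: "transpose a b \<in> ?Y" if "1 \<le> a" "a < b" "b \<le> n" "b \<le> l \<or> l < a" for a b
    using that
  proof (induction b)
    case (Suc b)
    show ?case
    proof (cases "a = b")
      case True
      then show ?thesis using Suc.prems by (auto intro: simple)
    next
      case False
      then have "transpose a b \<in> ?Y" "transpose b (Suc b) \<in> ?Y"
        using Suc by (auto intro: simple)
      moreover have "transpose a (Suc b) = transpose b (Suc b) \<circ> (transpose a b \<circ> transpose b (Suc b))"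
        using False Suc.prems by (auto simp: fun_eq_iff transpose_def)
      ultimately show ?thesis using comp by metis
    qed
  qed simp
  have tr: "transpose a b \<in> ?Y" if "a \<in> {1..n}" "b \<in> {1..n}" "a \<le> l \<longleftrightarrow> b \<le> l" for a b
    using less[of a b] less[of b a] id that
    by (cases a b rule: linorder_cases) (auto simp: transpose_commute)
  assume y: "y permutes {1..n} \<and> (\<forall>x\<in>{1..n}. y x \<le> l \<longleftrightarrow> x \<le> l)"
  have perm: "z \<in> ?Y" if "z permutes S" "S \<subseteq> {1..n}" "S \<subseteq> {..l} \<or> S \<subseteq> {l<..}" for z S
    using that(1) finite_subset[OF that(2) finite_atLeastAtMost]
  proof (induction z rule: permutes_induct)
    case (swap a b p)
    then have "transpose a b \<in> ?Y" using that by (intro tr) auto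
    then show ?case using swap comp by blast
  qed (rule id)
  define y1 y2 where "y1 = (\<lambda>x. if x \<le> l then y x else x)" and "y2 = (\<lambda>x. if x \<le> l then x else y x)"
  have yin: "y x \<in> {1..n}" if "x \<in> {1..n}" for x
    using that y permutes_in_image by metis
  have inj: "y x = y z \<longleftrightarrow> x = z" for x z
    using y permutes_inj by (metis injD)
  \<comment> \<open>\<open>l\<close> may exceed \<open>n\<close> here, so the lower block is cut off
    at \<open>min l n\<close>.\<close>
  have "y1 permutes {1..min l n}"
    using y yin by (intro inj_imp_permutes inj_onI) (auto simp: y1_def inj permutes_not_in)
  moreover have "y2 permutes {l+1..n}"
  proof (intro inj_imp_permutes inj_onI)
    fix x assume "x \<in> {l+1..n}"
    then show "y2 x \<in> {l+1..n}" using y yin[of x] by (auto simp: y2_def not_less_eq_eq[symmetric])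
  qed (use y in \<open>auto simp: y2_def inj permutes_not_in\<close>)
  ultimately have "y1 \<in> ?Y" "y2 \<in> ?Y"
    using perm[of y1 "{1..min l n}"] perm[of y2 "{l+1..n}"] by (auto simp: subset_iff)
  moreover have "y = y1 \<circ> y2"
  proof
    fix x
    have "\<not> y x \<le> l" if "\<not> x \<le> l"
      using that y by (cases "x \<in> {1..n}") (auto simp: permutes_not_in)
    then show "y x = (y1 \<circ> y2) x" by (auto simp: y1_def y2_def)
  qed
  ultimately show "y \<in> ?Y" using comp by metis
qed

section \<open>Minimal coset representatives and the factorization of permutations\<close>

lemma strict_mono_on_image_unique:
  fixes f g :: "nat \<Rightarrow> nat"
  assumes f: "strict_mono_on S f" and g: "strict_mono_on S g" and im: "f ` S = g ` S"
    and x: "x \<in> S"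
  shows "f x = g x"
  using x
proof (induction x rule: less_induct)
  case (less x)
  obtain y where y: "y \<in> S" "f x = g y"
    using im less.prems by blast
  obtain z where z: "z \<in> S" "g x = f z"
    using im[symmetric] less.prems by blast
  \<comment> \<open>If \<open>y < x\<close>, the induction hypothesis gives
    \<open>f y = g y = f x\<close>, against strictness. With the mirrored bound on \<open>z\<close>,
    monotonicity yields both \<open>g x \<le> f x\<close> and \<open>f x \<le> g x\<close>.\<close>
  have "x \<le> y"
  proof (rule ccontr)
    assume "\<not> x \<le> y"
    then have "f y = f x" using less.IH[of y] y by simp
    then show False
      using strict_mono_on_eq[OF f y(1) less.prems] \<open>\<not> x \<le> y\<close> by simp
  qed
  moreover have "x \<le> z"
  proof (rule ccontr)
    assume "\<not> x \<le> z"
    then have "g z = g x" using less.IH[of z] z by simp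
    then show False
      using strict_mono_on_eq[OF g z(1) less.prems] \<open>\<not> x \<le> z\<close> by simp
  qed
  ultimately show ?case
    using y z strict_mono_on_less_eq[OF f less.prems z(1)] strict_mono_on_less_eq[OF g less.prems y(1)]
    by simp
qed

lemma permutes_inv_image:
  assumes u: "u permutes A" and S: "S \<subseteq> A"
  shows "inv' u ` S = {x \<in> A. u x \<in> S}"
proof -
  have "inv' u ` S = u -` S"
    using permutes_bij[OF u] by (rule bij_vimage_eq_inv_image[symmetric])
  then show ?thesis using S permutes_in_image[OF u] by auto
qed

text \<open>By \<open>eq\<close> the two inverses have the same image on each block, and an
  increasing map is determined by its image.\<close>

lemma min_reps_eqI:
  assumes v: "v \<in> min_reps n l" and v': "v' \<in> min_reps n l" and "l \<le> n"
    and eq: "\<And>x. x \<in> {1..n} \<Longrightarrow> v x \<le> l \<longleftrightarrow> v' x \<le> l"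
  shows "v = v'"
proof -
  have p: "v permutes {1..n}" "v' permutes {1..n}"
    using v v' by (auto simp: min_reps_def sym_group_carrier)
  have rng: "v x \<in> {1..n}" "v' x \<in> {1..n}" if "x \<in> {1..n}" for x
    using that p permutes_in_image by metis+
  have "inv' v x = inv' v' x" if "x \<in> {1..l}" for x
  proof (rule strict_mono_on_image_unique[OF _ _ _ that])
    show "inv' v ` {1..l} = inv' v' ` {1..l}"
      using p \<open>l \<le> n\<close> eq rng
      by (subst (1 2) permutes_inv_image) auto
  qed (use v v' in \<open>auto simp: min_reps_def\<close>)
  moreover have "inv' v x = inv' v' x" if "x \<in> {l+1..n}" for x
  proof (rule strict_mono_on_image_unique[OF _ _ _ that])
    show "inv' v ` {l+1..n} = inv' v' ` {l+1..n}"
      using p eq rng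
      by (subst (1 2) permutes_inv_image) (auto simp: not_less_eq_eq[symmetric])
  qed (use v v' in \<open>auto simp: min_reps_def\<close>)
  moreover have "inv' v x = inv' v' x" if "x \<notin> {1..n}" for x
    using permutes_not_in[OF permutes_inv[OF p(1)] that] permutes_not_in[OF permutes_inv[OF p(2)] that]
    by simp
  ultimately have "inv' v = inv' v'" by (intro ext) (metis Suc_eq_plus1 atLeastAtMost_iff not_less_eq_eq)
  then show ?thesis using p by (metis permutes_inv_inv)
qed

text \<open>The inverse of the representative is built directly: it enumerates \<open>P\<close>
  increasingly on the first \<open>l\<close> arguments and the complement of \<open>P\<close> on the
  others.\<close>

lemma min_reps_exists:
  assumes "P \<subseteq> {1..n}" "card P = l"
  shows "\<exists>v \<in> min_reps n l. \<forall>x \<in> {1..n}. v x \<le> l \<longleftrightarrow> x \<in> P"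
proof -
  let ?Q = "{1..n} - P"
  have fin: "finite P" "finite ?Q" using assms finite_subset by auto
  have ln: "l \<le> n" and cQ: "card ?Q = n - l"
    using assms card_mono[OF _ assms(1)] fin by (auto simp: card_Diff_subset)
  obtain h1 where h1: "bij_betw h1 {..<card P} P" "strict_mono_on {..<card P} h1"
    using ex_bij_betw_strict_mono_card fin by blast
  obtain h2 where h2: "bij_betw h2 {..<card ?Q} ?Q" "strict_mono_on {..<card ?Q} h2"
    using ex_bij_betw_strict_mono_card fin by blast
  \<comment> \<open>The enumerations \<open>h1\<close> and \<open>h2\<close> start at 0, whence the
    shifts by \<open>1\<close> and \<open>l + 1\<close>.\<close>
  define g where "g x = (if x \<notin> {1..n} then x else if x \<le> l then h1 (x - 1) else h2 (x - l - 1))" for x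
  have s1: "bij_betw (\<lambda>x. x - 1) {1..l} {..<l}"
    by (rule bij_betw_byWitness[where f' = Suc]) auto
  have s2: "bij_betw (\<lambda>x. x - l - 1) {l+1..n} {..<n-l}"
    by (rule bij_betw_byWitness[where f' = "\<lambda>x. x + l + 1"]) auto
  have b1: "bij_betw g {1..l} P"
    using bij_betw_trans[OF s1 h1(1)[unfolded assms(2)]] ln
    by (subst bij_betw_cong[where g = "h1 \<circ> (\<lambda>x. x - 1)"]) (auto simp: g_def)
  have b2: "bij_betw g {l+1..n} ?Q"
    using bij_betw_trans[OF s2 h2(1)[unfolded cQ]]
    by (subst bij_betw_cong[where g = "h2 \<circ> (\<lambda>x. x - l - 1)"]) (auto simp: g_def)
  have "bij_betw g ({1..l} \<union> {l+1..n}) (P \<union> ?Q)"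
    using b1 b2 by (rule bij_betw_combine) auto
  moreover have "{1..l} \<union> {l+1..n} = {1..n}" "P \<union> ?Q = {1..n}" using ln assms by auto
  ultimately have g: "g permutes {1..n}"
    by (intro bij_imp_permutes) (auto simp: g_def)
  have m1: "strict_mono_on {1..l} g"
  proof (rule strict_mono_onI)
    fix x y assume xy: "x \<in> {1..l}" "y \<in> {1..l}" "x < y"
    then have "h1 (x - 1) < h1 (y - 1)"
      using assms(2) by (intro strict_mono_onD[OF h1(2)]) auto
    then show "g x < g y" using xy ln by (simp add: g_def)
  qed
  have m2: "strict_mono_on {l+1..n} g"
  proof (rule strict_mono_onI)
    fix x y assume xy: "x \<in> {l+1..n}" "y \<in> {l+1..n}" "x < y"
    then have "h2 (x - l - 1) < h2 (y - l - 1)"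
      using cQ by (intro strict_mono_onD[OF h2(2)]) auto
    then show "g x < g y" using xy by (simp add: g_def)
  qed
  show ?thesis
  proof (intro bexI ballI)
    show "inv' g \<in> min_reps n l"
      using g m1 m2 by (simp add: min_reps_def sym_group_carrier permutes_inv permutes_inv_inv)
    fix x assume x: "x \<in> {1..n}"
    then have "inv' g x \<in> {1..n}" using permutes_in_image[OF permutes_inv[OF g]] by blast
    moreover have "g (inv' g x) = x" using permutes_inverses[OF g] by simp
    moreover have "g z \<in> P \<longleftrightarrow> z \<le> l" if "z \<in> {1..n}" for z
      using that bij_betwE[OF b1] bij_betwE[OF b2] by (cases "z \<le> l") auto
    ultimately show "inv' g x \<le> l \<longleftrightarrow> x \<in> P" by metis
  qed
qed

lemma young_subgroup_compose:
  "y \<in> young_subgroup n l \<Longrightarrow> z \<in> young_subgroup n l \<Longrightarrow> y \<circ> z \<in> young_subgroup n l"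
  using permutes_in_image[of z "{1..n}"]
  by (auto simp: young_subgroup_iff intro: permutes_compose)

lemma min_reps_permutes: "v \<in> min_reps n l \<Longrightarrow> v permutes {1..n}"
  by (simp add: min_reps_def sym_group_carrier)

text \<open>Left multiplication by the Young subgroup preserves which positions carry values up to
  \<open>l\<close>. These positions determine the minimal representative, and what remains of
  \<open>w\<close> after removing it respects the two blocks.\<close>

lemma bij_betw_young_subgroup_min_reps:
  assumes ln: "l \<le> n"
  shows "bij_betw (\<lambda>(y, v). y \<circ> v) (young_subgroup n l \<times> min_reps n l) (Sn n)"
proof (intro bij_betw_imageI)
  show "inj_on (\<lambda>(y, v). y \<circ> v) (young_subgroup n l \<times> min_reps n l)"
  proof (intro inj_onI, clarify)
    fix y v y' v'
    assume y: "y \<in> young_subgroup n l" "y' \<in> young_subgroup n l"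
      and v: "v \<in> min_reps n l" "v' \<in> min_reps n l" and eq: "y \<circ> v = y' \<circ> v'"
    have "v = v'"
    proof (rule min_reps_eqI[OF v ln])
      fix x assume x: "x \<in> {1..n}"
      have "y (v x) = y' (v' x)" using eq by (metis comp_apply)
      moreover have "v x \<in> {1..n}" "v' x \<in> {1..n}"
        using x v permutes_in_image min_reps_permutes by metis+
      ultimately show "v x \<le> l \<longleftrightarrow> v' x \<le> l"
        using y unfolding young_subgroup_iff by metis
    qed
    moreover have "surj v" using v(1) min_reps_permutes permutes_surj by blast
    ultimately show "y = y' \<and> v = v'"
      using eq by (metis comp_apply surj_def ext)
  qed
  show "(\<lambda>(y, v). y \<circ> v) ` (young_subgroup n l \<times> min_reps n l) = Sn n"
  proof (intro equalityI subsetI)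
    fix w assume "w \<in> (\<lambda>(y, v). y \<circ> v) ` (young_subgroup n l \<times> min_reps n l)"
    then show "w \<in> Sn n"
      by (auto simp: sym_group_carrier young_subgroup_iff simp del: One_nat_def
          intro: permutes_compose[OF min_reps_permutes])
  next
    fix w assume "w \<in> Sn n"
    then have w: "w permutes {1..n}" by (simp add: sym_group_carrier)
    let ?P = "{x \<in> {1..n}. w x \<le> l}"
    have "inv' w ` {1..l} = ?P"
      using ln permutes_in_image[OF w] by (subst permutes_inv_image[OF w]) auto
    then have "card ?P = l"
      using card_image[OF permutes_inj_on[OF permutes_inv[OF w]]] by (metis card_atLeastAtMost diff_Suc_1)
    then obtain v where v: "v \<in> min_reps n l" "\<And>x. x \<in> {1..n} \<Longrightarrow> v x \<le> l \<longleftrightarrow> w x \<le> l"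
      using min_reps_exists[of ?P n l] by blast
    note pv = min_reps_permutes[OF v(1)]
    have "w \<circ> inv' v \<in> young_subgroup n l"
      unfolding young_subgroup_iff
    proof (intro conjI ballI)
      show "w \<circ> inv' v permutes {1..n}"
        using permutes_inv[OF pv] w by (rule permutes_compose)
      fix x assume "x \<in> {1..n}"
      then have "inv' v x \<in> {1..n}"
        using permutes_in_image[OF permutes_inv[OF pv]] by blast
      then show "(w \<circ> inv' v) x \<le> l \<longleftrightarrow> x \<le> l"
        using v(2)[of "inv' v x"] permutes_inverses(1)[OF pv, of x] by simp
    qed
    moreover have "w = (w \<circ> inv' v) \<circ> v"
      using permutes_inv_o[OF pv] by (simp add: comp_assoc)
    ultimately show "w \<in> (\<lambda>(y, v). y \<circ> v) ` (young_subgroup n l \<times> min_reps n l)"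
      using v(1) by (intro image_eqI[of _ _ "(w \<circ> inv' v, v)"]) auto
  qed
qed

section \<open>Bruhat order above vk\<close>

text \<open>Inversions of \<open>u\<close> inject into those of the product, and the image misses
  the new inversion \<open>(i, j)\<close>.\<close>

lemma perm_length_transpose_less:
  assumes u: "u permutes {1..n}" and ij: "i \<in> {1..n}" "j \<in> {1..n}" "i < j" and less: "u i < u j"
  shows "perm_length n u < perm_length n (u \<circ> transpose i j)"
proof -
  let ?t = "transpose i j" and ?w = "u \<circ> transpose i j"
  have fin: "finite (N_pos n x)" for x
    by (rule finite_subset[of _ "{1..n} \<times> {1..n}"]) (auto simp: N_pos_def Phi_pos_def)
  have tin: "?t a \<in> {1..n} \<longleftrightarrow> a \<in> {1..n}" for a
    using ij by (auto simp: transpose_def)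
  have N: "(a, b) \<in> N_pos n x \<longleftrightarrow> a \<in> {1..n} \<and> b \<in> {1..n} \<and> a < b \<and> x b < x a"
    if "x permutes {1..n}" for x a b
    using permutes_in_image[OF that] by (auto simp: N_pos_def Phi_pos_def Phi_neg_def act_def)
  have w: "?w permutes {1..n}"
    using u ij by (intro permutes_compose permutes_swap_id)
  \<comment> \<open>An inversion is moved along the transposition unless this would reverse it.\<close>
  define \<phi> where "\<phi> = (\<lambda>(a, b). if ?t a < ?t b then (?t a, ?t b) else (a, b))"
  have inj: "inj_on \<phi> (N_pos n u)"
    by (intro inj_onI) (auto simp: \<phi>_def N[OF u] transpose_eq_iff split: if_splits prod.splits)
  have sub: "\<phi> ` N_pos n u \<subseteq> N_pos n ?w - {(i, j)}"
  proof (intro image_subsetI, clarify)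
    fix a b assume ab: "(a, b) \<in> N_pos n u"
    show "\<phi> (a, b) \<in> N_pos n ?w - {(i, j)}"
    proof (cases "?t a < ?t b")
      case True
      have "(?t a, ?t b) \<noteq> (i, j)"
        using ab ij by (auto simp: N[OF u] transpose_eq_iff)
      moreover have "(?t a, ?t b) \<in> N_pos n ?w"
        using True ab tin[of a] tin[of b] by (simp add: N[OF u] N[OF w])
      ultimately show ?thesis using True by (simp add: \<phi>_def)
    next
      case False
      \<comment> \<open>The order is reversed only when \<open>a = i\<close> or
        \<open>b = j\<close>. Then \<open>u i < u j\<close> is chained with the inversion: for
        instance \<open>u b < u i < u j\<close> if \<open>a = i\<close> and
        \<open>b < j\<close>.\<close>
      have "u (?t b) < u (?t a)"
        using False ab ij less unfolding N[OF u] transpose_def by (auto split: if_splits)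
      moreover have "(a, b) \<noteq> (i, j)"
        using ab less by (auto simp: N[OF u])
      ultimately show ?thesis using False ab by (simp add: \<phi>_def N[OF u] N[OF w])
    qed
  qed
  have "(i, j) \<in> N_pos n ?w"
    using ij less by (simp add: N[OF w])
  then have "N_pos n ?w - {(i, j)} \<subset> N_pos n ?w" by blast
  then show ?thesis
    unfolding perm_length_def using card_image[OF inj] card_mono[OF _ sub] psubset_card_mono[OF fin]
    by (metis fin finite_Diff le_less_trans)
qed

text \<open>When \<open>u i > u j\<close>, the preceding lemma applied to the product, which has
  these two values in increasing order, shows that the length drops. So the length condition reduces
  to comparing two values.\<close>

lemma bruhat_step_iff:
  "bruhat_step n u w \<longleftrightarrow> u permutes {1..n} \<and>
    (\<exists>i\<in>{1..n}. \<exists>j\<in>{1..n}. i < j \<and> u i < u j \<and> w = u \<circ> transpose i j)"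
proof -
  have "perm_length n u < perm_length n (u \<circ> transpose i j) \<longleftrightarrow> u i < u j"
    if u: "u permutes {1..n}" and ij: "i \<in> {1..n}" "j \<in> {1..n}" "i < j" for i j
  proof
    assume less: "perm_length n u < perm_length n (u \<circ> transpose i j)"
    show "u i < u j"
    proof (rule ccontr)
      assume "\<not> u i < u j"
      moreover have "u i \<noteq> u j" using permutes_inj[OF u] ij(3) by (auto dest: injD)
      ultimately have "(u \<circ> transpose i j) i < (u \<circ> transpose i j) j" by simp
      moreover have "u \<circ> transpose i j permutes {1..n}"
        using permutes_swap_id[OF ij(1,2)] u by (rule permutes_compose)
      ultimately have "perm_length n (u \<circ> transpose i j) < perm_length n ((u \<circ> transpose i j) \<circ> transpose i j)"
        using ij by (intro perm_length_transpose_less)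
      then show False using less by (simp add: comp_assoc)
    qed
  qed (rule perm_length_transpose_less[OF u ij])
  then show ?thesis
    unfolding bruhat_step_def sym_group_carrier
    by (auto simp: Phi_pos_def refl_perm_def simp del: One_nat_def atLeastAtMost_iff)
qed

section \<open>The permutations \<open>vk\<close> and the minimal representatives above them\<close>

definition vk_pos :: "nat \<Rightarrow> nat \<Rightarrow> nat \<Rightarrow> nat \<Rightarrow> nat" where
  "vk_pos n l k x = (if x \<notin> {1..n} then x else if x = 1 then k + 1 else if x \<le> l then x + (n - l)
    else if x \<le> l + k then x - l else x - l + 1)"

text \<open>Only the side of \<open>l\<close> on which values lie enters, so the condition is
  insensitive to the Young subgroup. The positions left open are \<open>k + 1\<close> to
  \<open>n - l + 1\<close>; for a permutation meeting the condition, exactly one of the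
  \<open>l\<close> small values falls there.\<close>

definition above_vk :: "nat \<Rightarrow> nat \<Rightarrow> nat \<Rightarrow> (nat \<Rightarrow> nat) \<Rightarrow> bool" where
  "above_vk n l k w \<longleftrightarrow> (\<forall>x\<in>{1..k}. l < w x) \<and> (\<forall>x\<in>{n-l+2..n}. w x \<le> l)"

context
  fixes n l :: nat
  assumes l: "1 \<le> l" "l \<le> n"
begin

lemma vk_eq:
  assumes "k \<le> n - l"
  shows "vk n l k x = (if x \<notin> {1..n} then x else if x \<le> k then l + x else if x = k + 1 then 1
    else if x \<le> n - l + 1 then l + x - 1 else x - (n - l))"
  using assms l unfolding vk_def one_line_def
  by (auto simp: nth_append nth_Cons' simp del: upt_Suc)

lemma vk_pos_in: "k \<le> n - l \<Longrightarrow> x \<in> {1..n} \<Longrightarrow> vk_pos n l k x \<in> {1..n}"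
  using l by (auto simp: vk_pos_def)

lemma vk_vk_pos: "k \<le> n - l \<Longrightarrow> vk n l k (vk_pos n l k x) = x"
  using l by (auto simp: vk_eq vk_pos_def)

lemma vk_pos_vk: "k \<le> n - l \<Longrightarrow> vk_pos n l k (vk n l k x) = x"
  using l by (auto simp: vk_eq vk_pos_def)

lemma vk_permutes: "k \<le> n - l \<Longrightarrow> vk n l k permutes {1..n}"
proof (intro bij_imp_permutes bij_betw_byWitness[where f' = "vk_pos n l k"])
  assume k: "k \<le> n - l"
  show "vk n l k ` {1..n} \<subseteq> {1..n}" "vk_pos n l k ` {1..n} \<subseteq> {1..n}"
    using k l by (auto simp: vk_eq vk_pos_def)
  show "vk n l k x = x" if "x \<notin> {1..n}" for x
    using k that by (simp add: vk_eq)
qed (simp_all add: vk_pos_vk vk_vk_pos)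

lemma inv_vk: "k \<le> n - l \<Longrightarrow> inv' (vk n l k) = vk_pos n l k"
  by (intro inv_equality vk_vk_pos vk_pos_vk)

lemma vk_min_reps: "k \<le> n - l \<Longrightarrow> vk n l k \<in> min_reps n l"
  using l by (auto simp: min_reps_def sym_group_carrier vk_permutes inv_vk vk_pos_def intro!: strict_mono_onI
      simp del: One_nat_def)

text \<open>Since \<open>vk_pos\<close> inverts \<open>vk\<close>, the image under
  \<open>act\<close> becomes a condition on the positions of the two values, which can be computed
  case by case.\<close>

lemma mem_Sk_iff:
  assumes k: "k \<le> n - l"
  shows "(a, b) \<in> Sk n l h k \<longleftrightarrow> a \<in> {1..n} \<and> b \<in> {1..n} \<and> a < b \<and>
    vk_pos n l k b < vk_pos n l k a \<and> vk_pos n l k a \<le> h (vk_pos n l k b)" (is "_ \<longleftrightarrow> ?R")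
proof
  have v: "vk n l k x \<in> {1..n} \<longleftrightarrow> x \<in> {1..n}" for x
    using permutes_in_image[OF vk_permutes[OF k]] .
  {
    assume "(a, b) \<in> Sk n l h k"
    then show ?R
      by (auto simp: Sk_def act_def N_neg_h_def N_neg_def Phi_neg_def Phi_pos_def Phi_neg_h_def
          vk_pos_vk[OF k] v simp del: One_nat_def atLeastAtMost_iff)
  next
    assume R: ?R
    then have "(vk_pos n l k a, vk_pos n l k b) \<in> N_neg_h n h (vk n l k)"
      using vk_pos_in[OF k] vk_vk_pos[OF k]
      by (auto simp: act_def N_neg_h_def N_neg_def Phi_neg_def Phi_pos_def Phi_neg_h_def
          simp del: One_nat_def atLeastAtMost_iff)
    then show "(a, b) \<in> Sk n l h k"
      unfolding Sk_def by (rule rev_image_eqI) (simp add: act_def vk_vk_pos[OF k])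
  }
qed

text \<open>The exchange moves the larger value to the left. Position \<open>j\<close> receives a
  smaller value, but if \<open>j \<le> k\<close> then also \<open>i \<le> k\<close>, so
  \<open>u i\<close> exceeds \<open>l\<close> as well; the final segment is symmetric.\<close>

lemma above_vk_transpose:
  assumes "above_vk n l k u" "i < j" "u i < u j" "j \<le> n" "1 \<le> i"
  shows "above_vk n l k (u \<circ> transpose i j)"
  unfolding above_vk_def
proof (intro conjI ballI)
  fix x assume "x \<in> {1..k}"
  then have "l < u x" "x = j \<Longrightarrow> l < u i"
    using assms by (auto simp: above_vk_def)
  then show "l < (u \<circ> transpose i j) x"
    using assms(3) by (auto simp: transpose_def)
next
  fix x assume "x \<in> {n-l+2..n}"
  then have "u x \<le> l" "x = i \<Longrightarrow> u j \<le> l"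
    using assms by (auto simp: above_vk_def)
  then show "(u \<circ> transpose i j) x \<le> l"
    using assms(3) by (auto simp: transpose_def)
qed

text \<open>Counting leaves one small value outside the last \<open>l - 1\<close> positions; its
  position \<open>p\<close> determines the pattern of sides, hence the representative.\<close>

lemma above_vk_imp_vk:
  assumes k: "k \<le> n - l" and v: "v \<in> min_reps n l" and above: "above_vk n l k v"
  shows "\<exists>m. k \<le> m \<and> m \<le> n - l \<and> v = vk n l m"
proof -
  note pv = min_reps_permutes[OF v]
  let ?P = "{x \<in> {1..n}. v x \<le> l}" and ?R = "{n-l+2..n}"
  have "?P = inv' v ` {1..l}"
    using permutes_in_image[OF pv] l by (subst permutes_inv_image[OF pv]) auto
  then have "card ?P = l"
    using card_image[OF permutes_inj_on[OF permutes_inv[OF pv]]] by simp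
  moreover have sub: "?R \<subseteq> ?P" using above by (auto simp: above_vk_def)
  ultimately have "card (?P - ?R) = 1"
    using l by (subst card_Diff_subset) auto
  then obtain p where p: "?P - ?R = {p}" by (auto simp: card_1_singleton_iff)
  then have P: "?P = insert p ?R" using sub by blast
  have pin: "p \<in> {1..n}" "v p \<le> l" "p \<notin> ?R" using p by blast+
  then have "p \<notin> {1..k}" using above unfolding above_vk_def by (metis not_le)
  then have "\<not> p \<le> k" using pin(1) by simp
  \<comment> \<open>In \<open>vk n l m\<close> the value 1 stands at position
    \<open>m + 1\<close>.\<close>
  define m where "m = p - 1"
  have m: "k \<le> m" "m \<le> n - l" "p = m + 1" using pin \<open>\<not> p \<le> k\<close> by (auto simp: m_def)
  have "v = vk n l m"
  proof (rule min_reps_eqI[OF v vk_min_reps[OF m(2)] l(2)])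
    fix x assume x: "x \<in> {1..n}"
    then have "v x \<le> l \<longleftrightarrow> x \<in> insert p ?R" using P by blast
    then show "v x \<le> l \<longleftrightarrow> vk n l m x \<le> l"
      using x m l by (auto simp: vk_eq)
  qed
  then show ?thesis using m by blast
qed

lemma above_vk_vk: "k \<le> m \<Longrightarrow> m \<le> n - l \<Longrightarrow> above_vk n l k (vk n l m)"
  using l by (auto simp: above_vk_def vk_eq)

lemma bruhat_le_vk:
  assumes "k \<le> m" "m \<le> n - l"
  shows "bruhat_le n (vk n l k) (vk n l m)"
  using assms
proof (induction m rule: dec_induct)
  case (step m)
  \<comment> \<open>From \<open>m\<close> to \<open>Suc m\<close> the value 1 trades places with its
    right neighbour \<open>l + m + 1\<close>.\<close>
  have "vk n l (Suc m) = vk n l m \<circ> transpose (m + 1) (m + 2)"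
    using step.prems l by (auto simp: fun_eq_iff vk_eq transpose_def)
  moreover have "vk n l m (m + 1) < vk n l m (m + 2)" "m + 2 \<le> n"
    using step.prems l by (auto simp: vk_eq)
  ultimately have "bruhat_step n (vk n l m) (vk n l (Suc m))"
    unfolding bruhat_step_iff using step.prems vk_permutes[of m]
    by (intro conjI bexI[of _ "m + 1"] bexI[of _ "m + 2"]) auto
  then show ?case
    using step unfolding bruhat_le_def by (auto intro: rtranclp.rtrancl_into_rtrancl)
qed (simp add: bruhat_le_def)

text \<open>The condition holds at \<open>vk n l k\<close> and propagates up every Bruhat step.
  Conversely, a minimal representative satisfying it is some \<open>vk n l m\<close> with
  \<open>k \<le> m\<close>, and these form a chain.\<close>

lemma bruhat_le_vk_iff:
  assumes k: "k \<le> n - l" and v: "v \<in> min_reps n l"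
  shows "bruhat_le n (vk n l k) v \<longleftrightarrow> above_vk n l k v"
proof
  assume "bruhat_le n (vk n l k) v"
  then show "above_vk n l k v"
    unfolding bruhat_le_def
  proof (induction rule: rtranclp_induct)
    case base
    show ?case using k by (intro above_vk_vk) auto
  next
    case (step u w)
    then show ?case by (auto simp: bruhat_step_iff intro: above_vk_transpose)
  qed
next
  assume "above_vk n l k v"
  then show "bruhat_le n (vk n l k) v"
    using above_vk_imp_vk[OF k v] bruhat_le_vk by blast
qed

end

section \<open>The divisibility conditions\<close>

lemma comp_transpose_eq: "inj f \<Longrightarrow> f \<circ> transpose a b = transpose (f a) (f b) \<circ> f"
  by (auto simp: fun_eq_iff transpose_def dest: injD)

context
  fixes n l :: nat
  assumes l: "1 \<le> l" "l \<le> n"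
begin

text \<open>By unique factorization \<open>the_inv_into\<close> returns exactly
  \<open>(y, v)\<close>.\<close>

lemma f_class_comp:
  assumes "y \<in> young_subgroup n l" "v \<in> min_reps n l"
  shows "f_class n l h k (y \<circ> v) = f_value n l h k y v"
proof -
  have bij: "bij_betw (\<lambda>(y, v). y \<circ> v) (young_subgroup n l \<times> min_reps n l) (Sn n)"
    using l(2) by (rule bij_betw_young_subgroup_min_reps)
  have "y \<circ> v \<in> Sn n"
    using bij_betwE[OF bij] assms by (metis SigmaI case_prod_conv)
  then show ?thesis
    using the_inv_into_f_f[OF bij_betw_imp_inj_on[OF bij], of "(y, v)"] assms
    by (simp add: f_class_def)
qed

lemma Sn_factorization:
  assumes "w permutes {1..n}"
  obtains y v where "y \<in> young_subgroup n l" "v \<in> min_reps n l" "w = y \<circ> v"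
proof -
  have "w \<in> (\<lambda>(y, v). y \<circ> v) ` (young_subgroup n l \<times> min_reps n l)"
    using assms bij_betw_young_subgroup_min_reps[OF l(2)]
    by (simp add: bij_betw_def sym_group_carrier)
  then show ?thesis using that by auto
qed

lemma Sk_subset: "k \<le> n - l \<Longrightarrow> Sk n l h k \<subseteq> {1..n} \<times> {1..n}"
  using mem_Sk_iff[OF l] by (auto simp del: One_nat_def atLeastAtMost_iff)

lemma finite_Sk: "k \<le> n - l \<Longrightarrow> finite (Sk n l h k)"
  using Sk_subset finite_subset by blast

lemma young_diff_polys:
  assumes "y \<in> young_subgroup n l" "k \<le> n - l" "p \<in> Sk n l h k"
  shows "(case p of (a, b) \<Rightarrow> var (y a) - var (y b)) \<in> polys n"
proof -
  have "y permutes {1..n}" using assms(1) by (simp add: young_subgroup_iff)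
  then have "fst p \<in> {1..n}" "snd p \<in> {1..n}" "\<And>x. x \<in> {1..n} \<Longrightarrow> y x \<in> {1..n}"
    using Sk_subset[OF assms(2)] assms(3) permutes_in_image by (fastforce, fastforce, metis)
  then show ?thesis by (auto simp: case_prod_unfold intro!: polys_diff polys_var simp del: One_nat_def atLeastAtMost_iff)
qed

lemma f_value_polys:
  "y \<in> young_subgroup n l \<Longrightarrow> k \<le> n - l \<Longrightarrow> f_value n l h k y v \<in> polys n"
  by (auto simp: f_value_def intro: polys_prod young_diff_polys)

lemma f_value_homogeneous:
  "k \<le> n - l \<Longrightarrow> homogeneous (card (Sk n l h k)) (f_value n l h k y v)"
  by (auto simp: f_value_def intro!: homogeneous_prod finite_Sk homogeneous_diff homogeneous_var
      simp del: One_nat_def)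

lemma above_vk_young:
  assumes "y \<in> young_subgroup n l" "v permutes {1..n}" "k \<le> n"
  shows "above_vk n l k (y \<circ> v) \<longleftrightarrow> above_vk n l k v"
proof -
  have "y (v x) \<le> l \<longleftrightarrow> v x \<le> l" if "x \<in> {1..n}" for x
    using assms(1) permutes_in_image[OF assms(2)] that unfolding young_subgroup_iff by metis
  then have "l < y (v x) \<longleftrightarrow> l < v x" "y (v x) \<le> l \<longleftrightarrow> v x \<le> l" if "x \<in> {1..n}" for x
    using that by (simp_all add: not_le[symmetric])
  then show ?thesis using assms(3) by (simp add: above_vk_def)
qed

text \<open>Within a coset of the Young subgroup, the class is a single polynomial acted on by
  permutations of the variables.\<close>

lemma f_value_transpose_dvd:
  assumes y: "y \<in> young_subgroup n l" and k: "k \<le> n - l"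
    and pq: "p \<in> {1..n}" "q \<in> {1..n}" "p \<le> l \<longleftrightarrow> q \<le> l"
  shows "y \<circ> transpose p q \<in> young_subgroup n l"
    and "poly_dvd n (var (y p) - var (y q)) (f_value n l h k y v - f_value n l h k (y \<circ> transpose p q) v)"
proof -
  have "transpose p q \<in> young_subgroup n l"
    unfolding young_subgroup_iff
  proof
    show "transpose p q permutes {1..n}" using pq(1,2) by (rule permutes_swap_id)
    show "\<forall>x\<in>{1..n}. transpose p q x \<le> l \<longleftrightarrow> x \<le> l" using pq(3) by (auto simp: transpose_def)
  qed
  with y show t: "y \<circ> transpose p q \<in> young_subgroup n l" by (rule young_subgroup_compose)
  have "inj y" using y permutes_inj by (auto simp: young_subgroup_iff)
  let ?d = "var (y p) - var (y q)" and ?t = "transpose p q"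
  \<comment> \<open>Conjugation by \<open>y\<close> turns \<open>?t\<close> into the transposition
    of \<open>y p\<close> and \<open>y q\<close>.\<close>
  have var_dvd: "poly_dvd n ?d (var (y c) - var (y (?t c)))" for c
    using poly_dvd_var_transpose[of n "y p" "y q" "y c"] comp_transpose_eq[OF \<open>inj y\<close>]
    by (metis comp_apply)
  have "poly_dvd n ?d ((\<Prod>(a, b)\<in>Sk n l h k. var (y a) - var (y b)) -
      (\<Prod>(a, b)\<in>Sk n l h k. var ((y \<circ> ?t) a) - var ((y \<circ> ?t) b)))"
  proof (rule poly_dvd_prod_diff[OF finite_Sk[OF k] young_diff_polys[OF y k] young_diff_polys[OF t k]])
    fix r assume "r \<in> Sk n l h k"
    obtain a b where r: "r = (a, b)" by (cases r)
    have "poly_dvd n ?d ((var (y a) - var (y (?t a))) + - (var (y b) - var (y (?t b))))"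
      by (intro poly_dvd_add poly_dvd_uminus var_dvd)
    then show "poly_dvd n ?d ((case r of (a, b) \<Rightarrow> var (y a) - var (y b)) -
        (case r of (a, b) \<Rightarrow> var ((y \<circ> ?t) a) - var ((y \<circ> ?t) b)))"
      by (simp add: r algebra_simps)
  qed
  then show "poly_dvd n ?d (f_value n l h k y v - f_value n l h k (y \<circ> ?t) v)"
    by (simp add: f_value_def)
qed

section \<open>GKM edges under the hypothesis on \<open>h\<close>\<close>

context
  fixes h :: "nat \<Rightarrow> nat" and k :: nat
  assumes h: "hessenberg n h" and k: "k \<le> n - l" and h_top: "l > 1 \<Longrightarrow> h (k + 2) = n"
begin

lemma h_eq_top:
  assumes "l > 1" "x \<in> {k+2..n}"
  shows "h x = n"
proof -
  have "h (k + 2) \<le> h x"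
    using h assms unfolding hessenberg_def by (intro mono_onD[of "{1..n}" h]) auto
  moreover have "h x \<in> {1..n}"
    using h assms(2) unfolding hessenberg_def by (intro funcset_mem[of h "{1..n}"]) auto
  ultimately show ?thesis using h_top assms by simp
qed

text \<open>This serves edges leaving the support. Passing from \<open>vk n l m\<close> to
  \<open>vk n l k\<close> moves only 1 and the large values it crosses. If \<open>j \<le> k\<close>,
  then \<open>v j\<close> keeps its position and \<open>v i\<close> does not move right, so
  \<open>i \<le> h j\<close> suffices; otherwise \<open>v j\<close> lands at \<open>k + 2\<close> or
  later, where \<open>h\<close> is \<open>n\<close>.\<close>

lemma mem_Sk_of_above:
  assumes v: "v \<in> min_reps n l" "above_vk n l k v"
    and ij: "1 \<le> j" "j < i" "i \<le> n" "i \<le> h j" "v i \<le> l" "l < v j"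
    and edge: "j \<le> k \<or> n - l + 2 \<le> i"
  shows "(v i, v j) \<in> Sk n l h k"
proof -
  obtain m where m: "k \<le> m" "m \<le> n - l" "v = vk n l m"
    using above_vk_imp_vk[OF l k v] by blast
  have vi: "if i \<le> n - l + 1 then i = m + 1 \<and> v i = 1 else v i = i - (n - l)"
    using m(2) ij l by (simp add: m(3) vk_eq split: if_splits)
  have vj: "j \<noteq> m + 1" "j \<le> n - l + 1" "v j = (if j \<le> m then l + j else l + j - 1)"
    using m(2) ij l by (simp_all add: m(3) vk_eq split: if_splits)
  have pi: "vk_pos n l k (v i) = (if i \<le> n - l + 1 then k + 1 else i)" and im: "i \<le> n - l + 1 \<Longrightarrow> i = m + 1"
    using vi ij(3) l by (auto simp: vk_pos_def)
  have pj: "if j \<le> k then vk_pos n l k (v j) = j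
      else k + 2 \<le> vk_pos n l k (v j) \<and> vk_pos n l k (v j) \<le> n - l + 1"
    using vj ij(1) m(1,2) l k by (auto simp: vk_pos_def)
  have "vk_pos n l k (v j) < vk_pos n l k (v i)"
    using pi pj im edge ij m l by (auto split: if_splits)
  moreover have "vk_pos n l k (v i) \<le> h (vk_pos n l k (v j))"
  proof (cases "j \<le> k")
    case True
    then show ?thesis using pi pj im ij m by (auto split: if_splits)
  next
    case False
    \<comment> \<open>The remaining edge has \<open>n - l + 2 \<le> i \<le> n\<close>, so
      \<open>l \<ge> 2\<close> and the hypothesis on \<open>h (k + 2)\<close> applies.\<close>
    then have "l > 1" using edge ij l by auto
    then show ?thesis using h_eq_top[of "vk_pos n l k (v j)"] False pi pj edge ij by auto
  qed
  moreover have "v i \<in> {1..n}" "v j \<in> {1..n}"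
    using ij permutes_in_image[OF min_reps_permutes[OF v(1)], of i]
      permutes_in_image[OF min_reps_permutes[OF v(1)], of j] by auto
  ultimately show ?thesis using ij by (simp add: mem_Sk_iff[OF l k])
qed

text \<open>A value \<open>b > l + k\<close> stands to the right of 1 and of all large values below
  it, so its partner \<open>a\<close> lies between 2 and \<open>l\<close>, in the final segment.
  There \<open>s\<close> fixes \<open>a\<close> and keeps \<open>b\<close> at positions from
  \<open>k + 2\<close> on, where \<open>h\<close> equals \<open>n\<close>. Pairs with
  \<open>b \<le> l + k\<close> are fixed by \<open>s\<close>.\<close>

lemma Sk_invariant:
  assumes s: "s permutes {l+k+1..n}" and ab: "(a, b) \<in> Sk n l h k"
  shows "(s a, s b) \<in> Sk n l h k"
proof (cases "b \<le> l + k")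
  case True
  then have "s a = a" "s b = b"
    using ab by (auto simp: mem_Sk_iff[OF l k] intro!: permutes_not_in[OF s])
  then show ?thesis using ab by simp
next
  case False
  have a: "1 < a" "a \<le> l" and b: "b \<in> {l+k+1..n}"
    using ab False l by (auto simp: mem_Sk_iff[OF l k] vk_pos_def split: if_splits)
  have sa: "s a = a" using a by (intro permutes_not_in[OF s]) auto
  have sb: "s b \<in> {l+k+1..n}" using b permutes_in_image[OF s] by blast
  have pos: "vk_pos n l k a = a + (n - l)" "vk_pos n l k (s b) = s b - l + 1"
    using a sb l by (auto simp: vk_pos_def)
  then have "h (vk_pos n l k (s b)) = n"
    using a sb by (intro h_eq_top) auto
  then show ?thesis
    using a sb l by (simp add: mem_Sk_iff[OF l k] sa pos) linarith
qed

text \<open>The assumption \<open>less\<close> is membership of the root in \<open>N_neg\<close> and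
  orients the edge: the transposition removes an inversion of \<open>y \<circ> v\<close>, so the
  other endpoint lies below in Bruhat order.\<close>

lemma gkm_condition:
  assumes y: "y \<in> young_subgroup n l" and v: "v \<in> min_reps n l"
    and ij: "1 \<le> j" "j < i" "i \<le> n" "i \<le> h j" and less: "y (v i) < y (v j)"
  shows "poly_dvd n (var (y (v i)) - var (y (v j)))
    (f_class n l h k (y \<circ> v) - f_class n l h k (y \<circ> v \<circ> transpose i j))"
proof -
  note pv = min_reps_permutes[OF v]
  have py: "y permutes {1..n}" and y_le: "\<And>x. x \<in> {1..n} \<Longrightarrow> y x \<le> l \<longleftrightarrow> x \<le> l"
    using y by (auto simp: young_subgroup_iff)
  have ij_in: "i \<in> {1..n}" "j \<in> {1..n}" using ij by auto
  then have vij: "v i \<in> {1..n}" "v j \<in> {1..n}" using permutes_in_image[OF pv] by blast+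
  show ?thesis
  proof (cases "v i \<le> l \<longleftrightarrow> v j \<le> l")
    case True
    have "y \<circ> v \<circ> transpose i j = (y \<circ> transpose (v i) (v j)) \<circ> v"
      using comp_transpose_eq[OF permutes_inj[OF pv]] by (simp add: comp_assoc)
    then show ?thesis
      using f_value_transpose_dvd(1)[OF y k vij True] f_value_transpose_dvd(2)[OF y k vij True, of h v] y v
      by (simp only: f_class_comp)
  next
    case False
    \<comment> \<open>As \<open>y\<close> respects the sides, \<open>less\<close> forces the small
      value to be the one at \<open>i\<close>.\<close>
    have vl: "v i \<le> l" "l < v j"
      using False less y_le[OF vij(1)] y_le[OF vij(2)] by linarith+
    let ?t = "transpose i j"
    have pw: "y \<circ> v permutes {1..n}" "y \<circ> v \<circ> ?t permutes {1..n}"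
      using permutes_compose[OF pv py] permutes_compose[OF permutes_swap_id[OF ij_in]] by blast+
    obtain y' v' where y': "y' \<in> young_subgroup n l" and v': "v' \<in> min_reps n l"
      and eq: "y \<circ> v \<circ> ?t = y' \<circ> v'"
      using Sn_factorization[OF pw(2)] by blast
    note pv' = min_reps_permutes[OF v']
    have eqx: "y' (v' x) = y (v (?t x))" for x using eq by (metis comp_apply)
    \<comment> \<open>The representative \<open>v'\<close> of the other endpoint has the side
      pattern of \<open>v\<close> with positions \<open>i\<close> and \<open>j\<close>
      exchanged.\<close>
    have v'_le: "v' x \<le> l \<longleftrightarrow> v (?t x) \<le> l" if "x \<in> {1..n}" for x
    proof -
      have "?t x \<in> {1..n}" using that permutes_in_image[OF permutes_swap_id[OF ij_in]] by blast
      then have "v (?t x) \<in> {1..n}" using permutes_in_image[OF pv] by blast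
      moreover have "v' x \<in> {1..n}" using that permutes_in_image[OF pv'] by blast
      ultimately show ?thesis using y' y_le eqx[of x] unfolding young_subgroup_iff by metis
    qed
    have f': "f_class n l h k (y \<circ> v \<circ> ?t) = f_value n l h k y' v'"
      using eq y' v' by (simp only: f_class_comp)
    have f: "f_class n l h k (y \<circ> v) = f_value n l h k y v"
      using y v by (simp only: f_class_comp)
    have bruhat: "bruhat_le n (vk n l k) u \<longleftrightarrow> above_vk n l k u" if "u \<in> min_reps n l" for u
      using bruhat_le_vk_iff[OF l k that] .
    show ?thesis
    proof (cases "above_vk n l k v'")
      case False
      show ?thesis
      proof (cases "above_vk n l k v")
        case True
        have "j \<le> k \<or> n - l + 2 \<le> i"
        proof (rule ccontr)
          assume c: "\<not> ?thesis"
          \<comment> \<open>Were both positions in the window from \<open>k + 1\<close> to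
            \<open>n - l + 1\<close>, the exchange would not touch the pattern that
            \<open>above_vk\<close> tests.\<close>
          have "?t x = x" if "x \<in> {1..k} \<or> x \<in> {n-l+2..n}" for x
            using that c ij by (auto simp: transpose_def)
          then have "v' x \<le> l \<longleftrightarrow> v x \<le> l" if "x \<in> {1..k} \<or> x \<in> {n-l+2..n}" for x
            using that v'_le[of x] l k by auto
          then have "above_vk n l k v'"
            using True unfolding above_vk_def by (metis not_le)
          then show False using False by simp
        qed
        then have "(v i, v j) \<in> Sk n l h k"
          using v True ij vl by (intro mem_Sk_of_above)
        then have "poly_dvd n (var (y (v i)) - var (y (v j)))
            (\<Prod>(a, b)\<in>Sk n l h k. var (y a) - var (y b))"
          by (rule poly_dvd_prod_factor[OF finite_Sk[OF k]]) (simp_all add: young_diff_polys[OF y k])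
        then show ?thesis
          using True False by (simp add: f f' f_value_def bruhat v v')
      next
        case False
        then show ?thesis
          using \<open>\<not> above_vk n l k v'\<close> by (simp add: f f' f_value_def bruhat v v')
      qed
    next
      case above': True
      \<comment> \<open>The endpoint \<open>y \<circ> v\<close> arises from the lower one by an
        upward exchange, so it lies in the support as well.\<close>
      have "above_vk n l k (y \<circ> v \<circ> ?t)"
        using above_vk_young[OF y' pv'] above' k by (simp add: eq)
      moreover have "(y \<circ> v \<circ> ?t) j < (y \<circ> v \<circ> ?t) i" using less by simp
      ultimately have "above_vk n l k (y \<circ> v \<circ> ?t \<circ> transpose j i)"
        by (rule above_vk_transpose[OF l _ ij(2) _ _ ij(1)]) (use ij in simp)
      moreover have "y \<circ> v \<circ> ?t \<circ> transpose j i = y \<circ> v"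
        by (simp add: fun_eq_iff transpose_commute[of j i])
      ultimately have above: "above_vk n l k v"
        using above_vk_young[OF y pv] k by simp
      obtain m where m: "k \<le> m" "m \<le> n - l" "v = vk n l m"
        using above_vk_imp_vk[OF l k v above] by blast
      obtain m' where m': "k \<le> m'" "m' \<le> n - l" "v' = vk n l m'"
        using above_vk_imp_vk[OF l k v' above'] by blast
      have v'l: "v' j \<le> l" "l < v' i"
        using v'_le[OF ij_in(1)] v'_le[OF ij_in(2)] vl by auto
      have "j \<notin> {1..k}" "i \<notin> {n-l+2..n}"
        using v'l above' unfolding above_vk_def by (metis not_le)+
      then have "k < j" "i < n - l + 2" using ij by auto
      note ijb = this
      have i: "i = m + 1"
        using vl(1) ij_in(1) ijb(2) l by (simp add: m(3) vk_eq[OF l m(2)] split: if_splits)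
      have j: "j = m' + 1"
        using v'l(1) ij_in(2) ij(2) ijb(2) l by (simp add: m'(3) vk_eq[OF l m'(2)] split: if_splits)
      \<comment> \<open>The discrepancy between the two Young components; it will be shown to fix
        every value up to \<open>l + k\<close>.\<close>
      define s where "s = inv' y \<circ> y'"
      have ys: "y (s x) = y' x" for x
        using permutes_inverses(1)[OF py] by (simp add: s_def)
      have "y' x = y x" if x: "x \<in> {1..n} - {l+k+1..n}" for x
      proof -
        \<comment> \<open>Among values up to \<open>l + k\<close>, only 1 changes position between
          \<open>v'\<close> and \<open>v\<close>, from \<open>j\<close> to \<open>i\<close>, and
          \<open>?t\<close> exchanges these; the positions of the others avoid both.\<close>
        have "?t (vk_pos n l m' x) = vk_pos n l m x"
        proof -
          consider "x = 1" | "1 < x" "x \<le> l" | "l < x" "x \<le> l + k" using x by fastforce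
          then show ?thesis
          proof cases
            case 1
            then show ?thesis using l by (simp add: vk_pos_def i j)
          next
            case 2
            then have "vk_pos n l m' x = x + (n - l)" "vk_pos n l m x = x + (n - l)"
              using x by (simp_all add: vk_pos_def)
            moreover have "x + (n - l) \<noteq> i" "x + (n - l) \<noteq> j"
              using 2 ijb(2) ij(2) by linarith+
            ultimately show ?thesis by simp
          next
            case 3
            then have "vk_pos n l m' x = x - l" "vk_pos n l m x = x - l"
              using x m(1) m'(1) l by (simp_all add: vk_pos_def)
            moreover have "x - l \<noteq> i" "x - l \<noteq> j"
              using 3 ijb(1) ij(2) by linarith+
            ultimately show ?thesis by simp
          qed
        qed
        then show ?thesis
          using eqx[of "vk_pos n l m' x"] by (simp add: m(3) m'(3) vk_vk_pos[OF l] m(2) m'(2))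
      qed
      then have "s x = x" if "x \<in> {1..n} - {l+k+1..n}" for x
        using that ys permutes_inj[OF py] by (metis injD)
      moreover have "s permutes {1..n}"
        unfolding s_def
        using y' by (intro permutes_compose permutes_inv[OF py]) (simp add: young_subgroup_iff)
      ultimately have s: "s permutes {l+k+1..n}"
        by (rule permutes_superset[rotated])
      let ?S = "Sk n l h k"
      have inj: "inj_on (act s) ?S"
        by (auto simp: inj_on_def act_def inj_eq[OF permutes_inj[OF s]])
      \<comment> \<open>An injective self-map of a finite set is onto, so reindexing by
        \<open>s\<close> turns the product for \<open>y\<close> into the one for \<open>y'\<close>,
        and the difference vanishes.\<close>
      have "act s ` ?S = ?S"
        using Sk_invariant[OF s] by (intro endo_inj_surj finite_Sk[OF k] inj) (auto simp: act_def)
      then have "(\<Prod>(a, b)\<in>?S. var (y a) - var (y b)) = (\<Prod>(a, b)\<in>?S. var (y (s a)) - var (y (s b)))"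
        using prod.reindex[OF inj, of "\<lambda>(a, b). var (y a) - var (y b)"]
        by (simp add: act_def case_prod_unfold comp_def)
      then show ?thesis
        using above above' by (simp add: f f' f_value_def bruhat v v' ys)
    qed
  qed
qed

lemma f_class_HT_even: "f_class n l h k \<in> HT_even n h (card (Sk n l h k))"
proof -
  have val: "f_class n l h k w \<in> polys n \<and> homogeneous (card (Sk n l h k)) (f_class n l h k w)"
    if "w permutes {1..n}" for w
    using Sn_factorization[OF that] f_value_polys[OF _ k] f_value_homogeneous[OF k] f_class_comp
    by metis
  have gkm: "poly_dvd n (root_poly (act w (i, j)))
      (f_class n l h k w - f_class n l h k (w \<circ> refl_perm (i, j)))"
    if w: "w permutes {1..n}" and ij: "(i, j) \<in> N_neg_h n h w" for w i j
  proof -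
    obtain y v where yv: "y \<in> young_subgroup n l" "v \<in> min_reps n l" "w = y \<circ> v"
      using Sn_factorization[OF w] by blast
    have "1 \<le> j" "j < i" "i \<le> n" "i \<le> h j" "y (v i) < y (v j)"
      using ij yv(3) by (auto simp: N_neg_h_def N_neg_def Phi_neg_def Phi_neg_h_def Phi_pos_def act_def)
    from gkm_condition[OF yv(1,2) this] show ?thesis
      by (simp add: yv(3) root_poly_def act_def refl_perm_def)
  qed
  show ?thesis
    unfolding HT_even_def HT_def PiE_iff sym_group_carrier
  proof (intro CollectI conjI ballI)
    show "f_class n l h k \<in> extensional (Sn n)" by (simp add: f_class_def)
  qed (use val gkm in \<open>auto simp: sym_group_carrier simp del: One_nat_def atLeastAtMost_iff\<close>)
qed

end

end

theorem theorem4p8: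
  fixes n l1 l2 k :: nat and h :: "nat \<Rightarrow> nat"
  assumes "n \<ge> 2"
    and "hessenberg n h"
    and "l1 \<ge> 1" and "l2 \<ge> 1" and "l1 + l2 = n"
    and "k \<le> l2"
    and "l1 > 1 \<Longrightarrow> h (k + 2) = n"
  shows "bij_betw (\<lambda>(y, v). y \<circ> v) (young_subgroup n l1 \<times> min_reps n l1) (Sn n)
    \<and> (\<forall>y \<in> young_subgroup n l1. \<forall>v \<in> min_reps n l1.
         f_class n l1 h k (y \<circ> v) =
           (if bruhat_le n (vk n l1 k) v
            then \<Prod>(a, b) \<in> Sk n l1 h k. (var (y a) - var (y b)) else 0))
    \<and> f_class n l1 h k \<in> HT_even n h (card (Sk n l1 h k))"
proof -
  have "l1 \<le> n" "k \<le> n - l1" using assms by auto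
  then show ?thesis
    using assms bij_betw_young_subgroup_min_reps f_class_HT_even
    by (simp add: f_class_comp f_value_def)
qed

end
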